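(* Let $k,n\ge 1$, let $a_{ij}\in\mathbb{Z}$ for $1\le i\le k$, $1\le j\le n$, let $b_1,\dots,b_k\in\mathbb{Z}$, and let $m_1,\dots,m_k$ be pairwise coprime positive integers with $m=m_1\cdots m_k$. Consider the system of congruences \[ a_{i1}x_1+a_{i2}x_2+\dots+a_{in}x_n\equiv b_i \pmod{m_i},\qquad 1\le i\le k . \] For $1\le i\le k$ let $\ell_i=(a_{i1},\dots,a_{in},m_i)$. Then the system has a solution $(x_1,\dots,x_n)\in\mathbb{Z}_m^n$ if and only if $\ell_i\mid b_i$ for every $1\le i\le k$; and if this condition holds, the number of solutions $(x_1,\dots,x_n)\in\mathbb{Z}_m^n$ is $m^{n-1}\prod_{i=1}^k \ell_i$.
   Context: $(u_1,\dots,u_r)$ denotes the greatest common divisor of integers $u_1,\dots,u_r$; $\mathbb{Z}_m=\mathbb{Z}/m\mathbb{Z}$. *)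

theory Defs
  imports "HOL-Number_Theory.Number_Theory"
begin

text \<open>
  Elements of $\mathbb{Z}_M$ are represented as in \<^const>\<open>residue_ring\<close>, by the integers
  $0, \dots, M - 1$, and elements of $\mathbb{Z}_M^n$ by extensional functions on $\{1..n\}$.
  Since every \<open>m i\<close> divides \<open>\<Prod>i\<in>{1..k}. m i\<close>, whether the congruences hold does not depend on the
  choice of representatives modulo that product.
\<close>

definition solutions ::
  "nat \<Rightarrow> nat \<Rightarrow> (nat \<Rightarrow> nat \<Rightarrow> int) \<Rightarrow> (nat \<Rightarrow> int) \<Rightarrow> (nat \<Rightarrow> int) \<Rightarrow> (nat \<Rightarrow> int) set"
  where "solutions k n a b m =
    {x \<in> {1..n} \<rightarrow>\<^sub>E carrier (residue_ring (\<Prod>i\<in>{1..k}. m i)).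
       \<forall>i\<in>{1..k}. [(\<Sum>j\<in>{1..n}. a i j * x j) = b i] (mod m i)}"

definition row_gcd :: "nat \<Rightarrow> (nat \<Rightarrow> nat \<Rightarrow> int) \<Rightarrow> (nat \<Rightarrow> int) \<Rightarrow> nat \<Rightarrow> int"
  where "row_gcd n a m i = Gcd (insert (m i) ((\<lambda>j. a i j) ` {1..n}))"

end

theory Submission
  imports Defs
begin

text \<open>
  By the Chinese remainder theorem the system is equivalent to one congruence
  $A_1 x_1 + \dots + A_n x_n \equiv B$ modulo $m$ with $A_j \equiv a_{ij}$ and $B \equiv b_i$
  modulo $m_i$, and $(A_1, \dots, A_n, m) = \ell_1 \cdots \ell_k$ because the $m_i$ are coprime.
  For one congruence, induct on the number of unknowns: with the value $y$ of a new unknown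
  fixed, the others can be chosen iff $\ell$, the gcd of $m$ and the other coefficients, divides
  $B - A y$. This is again a congruence in one unknown.
\<close>

section \<open>Gcds, divisibility and congruences for pairwise coprime moduli\<close>

text \<open>The two factors on the right are coprime and both divide \<open>a\<close>, so their
  product does; it divides \<open>b * c\<close> factor by factor. Conversely the left side divides
  \<open>c * a\<close> and \<open>c * b\<close>, hence \<open>c * gcd a b\<close>, and it divides
  \<open>gcd a b * a\<close>; together these give \<open>gcd a b * gcd a c\<close>.\<close>

lemma gcd_mult_right_coprime:
  fixes a b c :: int
  assumes "coprime b c"
  shows "gcd a (b * c) = gcd a b * gcd a c"
proof (rule zdvd_antisym_nonneg)
  have "coprime (gcd a b) (gcd a c)"
    using assms by (meson coprime_divisors gcd_dvd2)
  then show "gcd a b * gcd a c dvd gcd a (b * c)"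
    by (intro gcd_greatest divides_mult mult_dvd_mono) auto
  have "gcd a (b * c) dvd gcd (c * a) (c * b)"
    by (intro gcd_greatest) (auto simp: mult.commute[of c])
  also have "\<dots> dvd c * gcd a b"
    by (simp flip: gcd_mult_distrib_int)
  finally have "gcd a (b * c) dvd gcd (gcd a b * a) (gcd a b * c)"
    by (intro gcd_greatest) (auto simp: mult.commute)
  then show "gcd a (b * c) dvd gcd a b * gcd a c"
    by (simp flip: gcd_mult_distrib_int)
qed auto

lemma gcd_prod_right_coprime:
  fixes a :: int and m :: "'i \<Rightarrow> int"
  assumes "finite I" "pairwise (\<lambda>i j. coprime (m i) (m j)) I"
  shows "gcd a (\<Prod>i\<in>I. m i) = (\<Prod>i\<in>I. gcd a (m i))"
  using assms
proof (induction I)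
  case (insert i I)
  then have "coprime (m i) (prod m I)"
    by (intro prod_coprime_right) (auto simp: pairwise_insert)
  with insert show ?case
    by (simp add: gcd_mult_right_coprime pairwise_insert)
qed simp

text \<open>Serves twice in the theorem: for the moduli \<open>m i\<close>, to merge the congruences
  into one, and for the row gcds, to split the solvability condition into one per row.\<close>

lemma prod_dvd_iff_coprime:
  fixes l :: "'i \<Rightarrow> int"
  assumes "finite I" "pairwise (\<lambda>i j. coprime (l i) (l j)) I"
  shows "(\<Prod>i\<in>I. l i) dvd b \<longleftrightarrow> (\<forall>i\<in>I. l i dvd b)"
  using assms
proof (induction I)
  case (insert i I)
  then have "coprime (l i) (prod l I)"
    by (intro prod_coprime_right) (auto simp: pairwise_insert)
  then have "l i * prod l I dvd b \<longleftrightarrow> l i dvd b \<and> prod l I dvd b"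
    by (auto intro: divides_mult dest: dvd_mult_left dvd_mult_right)
  with insert show ?case
    by (simp add: pairwise_insert)
qed simp

text \<open>A solution \<open>y\<close> for \<open>I\<close> is corrected by a multiple of
  \<open>prod m I\<close>, which changes nothing modulo the old moduli; a suitable multiplier
  \<open>t\<close> exists because \<open>prod m I\<close> is invertible modulo
  \<open>m i\<close>.\<close>

lemma chinese_remainder_int:
  fixes m u :: "'i \<Rightarrow> int"
  assumes "finite I" "pairwise (\<lambda>i j. coprime (m i) (m j)) I"
  shows "\<exists>x. \<forall>i\<in>I. [x = u i] (mod m i)"
  using assms
proof (induction I)
  case (insert i I)
  then obtain y where y: "[y = u j] (mod m j)" if "j \<in> I" for j
    by (auto simp: pairwise_insert)
  have "coprime (prod m I) (m i)"
    using insert by (intro prod_coprime_left) (auto simp: pairwise_insert)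
  then have "gcd (prod m I) (m i) dvd u i - y"
    by simp
  from cong_solve_dvd_int[OF this] obtain t where t: "[prod m I * t = u i - y] (mod m i)" ..
  have "[y + prod m I * t = u j] (mod m j)" if "j \<in> I" for j
  proof -
    have "m j dvd prod m I * t"
      using insert.hyps(1) that by (intro dvd_mult2 dvd_prodI)
    with y[OF that] show ?thesis
      by (simp add: cong_iff_dvd_diff add_diff_eq diff_add_eq[symmetric])
  qed
  moreover have "[y + prod m I * t = u i] (mod m i)"
    using t by (simp add: cong_iff_dvd_diff algebra_simps)
  ultimately show ?case
    by (intro exI[of _ "y + prod m I * t"]) auto
qed simp

section \<open>One congruence in one unknown\<close>

lemma card_residue_class:
  fixes M d c :: int
  assumes "M > 0" "d > 0" "d dvd M"
  shows "int (card {x \<in> {0..<M}. [x = c] (mod d)}) = M div d"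
proof -
  have "bij_betw (\<lambda>t. c mod d + d * t) {0..<M div d} {x \<in> {0..<M}. [x = c] (mod d)}"
  proof (rule bij_betw_byWitness[where f' = "\<lambda>x. x div d"])
    show "(\<lambda>t. c mod d + d * t) ` {0..<M div d} \<subseteq> {x \<in> {0..<M}. [x = c] (mod d)}"
    proof (clarsimp, intro conjI)
      fix t assume t: "0 \<le> t" "t < M div d"
      show "0 \<le> c mod d + d * t"
        using assms t by simp
      have "c mod d + d * t < d * (t + 1)"
        using assms by (simp add: algebra_simps)
      also have "\<dots> \<le> d * (M div d)"
        using assms t by (intro mult_left_mono) auto
      finally show "c mod d + d * t < M"
        using assms by simp
      show "[c mod d + d * t = c] (mod d)"
        by (simp add: cong_def)
    qed
    show "(\<lambda>x. x div d) ` {x \<in> {0..<M}. [x = c] (mod d)} \<subseteq> {0..<M div d}"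
    proof (clarsimp, intro conjI)
      fix x assume x: "0 \<le> x" "x < M"
      show "0 \<le> x div d"
        using assms x by (simp add: pos_imp_zdiv_nonneg_iff)
      have "x div d * d \<le> x"
        using assms by (simp add: minus_mod_eq_div_mult[symmetric])
      also have "x < M div d * d"
        using assms x by simp
      finally show "x div d < M div d"
        using assms(2) by (rule mult_right_less_imp_less[OF _ less_imp_le])
    qed
    show "\<forall>t\<in>{0..<M div d}. (c mod d + d * t) div d = t"
      using assms by simp
    show "\<forall>x\<in>{x \<in> {0..<M}. [x = c] (mod d)}. c mod d + d * (x div d) = x"
      by (auto simp: cong_def) (metis mod_mult_div_eq)
  qed
  then have "card {x \<in> {0..<M}. [x = c] (mod d)} = card {0..<M div d}"
    by (rule bij_betw_same_card[symmetric])
  then show ?thesis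
    using assms by (simp add: pos_imp_zdiv_nonneg_iff)
qed

text \<open>Dividing by \<open>gcd a l\<close> turns a solvable congruence into a single residue
  class modulo \<open>l div gcd a l\<close>. The modulus \<open>l\<close> may be a proper divisor of
  \<open>M\<close>: in the induction below it is a gcd of \<open>M\<close> with coefficients, while
  the unknown still ranges over residues modulo \<open>M\<close>.\<close>

lemma card_linear_cong_single:
  fixes M l a b :: int
  assumes "M > 0" "l > 0" "l dvd M"
  shows "int (card {x \<in> {0..<M}. [a * x = b] (mod l)}) * l =
    (if gcd a l dvd b then M * gcd a l else 0)"
proof (cases "gcd a l dvd b")
  case True
  then obtain x0 where x0: "[a * x0 = b] (mod l)"
    using cong_solve_dvd_int by blast
  define g where "g = gcd a l"
  have g: "g > 0" "g dvd l" "g dvd a"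
    using assms by (auto simp: g_def)
  then obtain d a' where d: "l = g * d" "a = g * a'"
    by (elim dvdE)
  have "d > 0"
    using assms(2) g(1) d(1) by (simp add: zero_less_mult_iff)
  have "d dvd M"
    using assms(3) unfolding d(1) by (rule dvd_mult_right)
  have "coprime a' d"
  proof (rule gcd_coprime)
    show "gcd a l \<noteq> 0" "a = a' * gcd a l" "l = d * gcd a l"
      unfolding g_def[symmetric] using g(1) d by (simp_all only: mult.commute)
  qed
  have "[a * x = b] (mod l) \<longleftrightarrow> [x = x0] (mod d)" for x
  proof -
    have "[a * x = b] (mod l) \<longleftrightarrow> [a * x = a * x0] (mod l)"
      using x0 by (simp add: cong_def)
    also have "\<dots> \<longleftrightarrow> [a' * x = a' * x0] (mod d)"
      using g by (simp add: d cong_iff_dvd_diff mult.assoc flip: right_diff_distrib)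
    also have "\<dots> \<longleftrightarrow> [x = x0] (mod d)"
      using \<open>coprime a' d\<close> by (rule cong_mult_lcancel)
    finally show ?thesis .
  qed
  then have "int (card {x \<in> {0..<M}. [a * x = b] (mod l)}) = M div d"
    using card_residue_class[OF \<open>M > 0\<close> \<open>d > 0\<close> \<open>d dvd M\<close>] by simp
  moreover have "M div d * l = M * gcd a l"
    using \<open>d dvd M\<close> unfolding g_def[symmetric] unfolding d(1) by (elim dvdE) simp
  ultimately show ?thesis
    using True by simp
next
  case False
  \<comment> \<open>\<open>gcd a l\<close> divides both \<open>a * x\<close> and the modulus, so a
    solution would force it to divide \<open>b\<close>.\<close>
  have "\<not> [a * x = b] (mod l)" for x
    using False cong_dvd_iff[of "a * x" b "gcd a l"] cong_dvd_modulus[of "a * x" b l "gcd a l"]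
    by auto
  with False show ?thesis
    by simp
qed

section \<open>One congruence in several unknowns\<close>

text \<open>
  Both sides carry an extra factor \<open>M\<close>, so that the formula also holds for \<open>J = {}\<close>.
\<close>

lemma card_linear_cong:
  fixes M b :: int and a :: "'j \<Rightarrow> int"
  assumes "M > 0" "finite J"
  shows "int (card {x \<in> J \<rightarrow>\<^sub>E {0..<M}. [(\<Sum>j\<in>J. a j * x j) = b] (mod M)}) * M =
    (if Gcd (insert M (a ` J)) dvd b then M ^ card J * Gcd (insert M (a ` J)) else 0)"
  using assms(2)
proof (induction J arbitrary: b)
  case empty
  \<comment> \<open>The only candidate is the function undefined everywhere, and the congruence
    reads 0 = \<open>b\<close>. The gcd is \<open>M\<close> itself, so both sides are
    \<open>M\<close> or 0.\<close>
  have "{x \<in> {} \<rightarrow>\<^sub>E {0..<M}. [(\<Sum>j\<in>{}. a j * x j) = b] (mod M)} =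
      (if M dvd b then {\<lambda>_. undefined} else {})"
    by (auto simp: cong_0_iff cong_sym_eq[of 0])
  then show ?case
    using assms(1) by (simp only: image_empty) simp
next
  case (insert j J)
  define l where "l = Gcd (insert M (a ` J))"
  define S where "S b = {x \<in> J \<rightarrow>\<^sub>E {0..<M}. [(\<Sum>j\<in>J. a j * x j) = b] (mod M)}" for b
  define T where "T = {x \<in> insert j J \<rightarrow>\<^sub>E {0..<M}. [(\<Sum>j\<in>insert j J. a j * x j) = b] (mod M)}"
  have "l dvd M"
    by (simp add: l_def)
  then have "l \<noteq> 0"
    using assms(1) by auto
  moreover have "l \<ge> 0"
    by (simp add: l_def)
  ultimately have "l > 0"
    by simp
  have finS: "finite (S c)" for c
    unfolding S_def using insert.hyps by (intro finite_Collect_conjI disjI1) (simp add: finite_PiE)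
  have card_S: "int (card (S c)) * M = (if l dvd c then M ^ card J * l else 0)" for c
    unfolding S_def l_def by (rule insert.IH)
  have upd: "(\<Sum>i\<in>insert j J. a i * (x(j := y)) i) = a j * y + (\<Sum>i\<in>J. a i * x i)" for x y
    using insert.hyps by (simp, intro sum.cong) auto
  have cong_shift: "[a j * y + s = b] (mod M) \<longleftrightarrow> [s = b - a j * y] (mod M)" for y s
    by (simp add: cong_iff_dvd_diff algebra_simps)
  \<comment> \<open>Fibre the solutions over the value \<open>y\<close> of the new unknown: the
    remaining values solve the congruence over \<open>J\<close> with right side
    \<open>b - a j * y\<close>.\<close>
  have "T = (\<lambda>(y, x). x(j := y)) ` (SIGMA y:{0..<M}. S (b - a j * y))"
  proof -
    have "T = {z \<in> (\<lambda>(y, x). x(j := y)) ` ({0..<M} \<times> (J \<rightarrow>\<^sub>E {0..<M})).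
        [(\<Sum>i\<in>insert j J. a i * z i) = b] (mod M)}"
      unfolding T_def PiE_insert_eq ..
    also have "\<dots> = (\<lambda>(y, x). x(j := y)) ` {(y, x) \<in> {0..<M} \<times> (J \<rightarrow>\<^sub>E {0..<M}).
        [(\<Sum>i\<in>insert j J. a i * (x(j := y)) i) = b] (mod M)}"
      by auto
    also have "{(y, x) \<in> {0..<M} \<times> (J \<rightarrow>\<^sub>E {0..<M}).
        [(\<Sum>i\<in>insert j J. a i * (x(j := y)) i) = b] (mod M)} =
        (SIGMA y:{0..<M}. S (b - a j * y))"
      unfolding upd cong_shift S_def by auto
    finally show ?thesis .
  qed
  moreover have "inj_on (\<lambda>(y, x). x(j := y)) (SIGMA y:{0..<M}. S (b - a j * y))"
    using insert.hyps(2)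
    by (rule inj_on_subset[OF inj_combinator[of j J "\<lambda>_. {0..<M}"]]) (auto simp: S_def)
  ultimately have "card T = card (SIGMA y:{0..<M}. S (b - a j * y))"
    by (simp add: card_image)
  also have "\<dots> = (\<Sum>y\<in>{0..<M}. card (S (b - a j * y)))"
    using finS by simp
  finally have "int (card T) * M = (\<Sum>y\<in>{0..<M}. int (card (S (b - a j * y))) * M)"
    by (simp add: sum_distrib_right)
  \<comment> \<open>By the induction hypothesis all nonempty fibres have the same size, and a fibre
    is nonempty iff \<open>l\<close> divides \<open>b - a j * y\<close>. It remains to count such
    \<open>y\<close>.\<close>
  also have "\<dots> = (\<Sum>y\<in>{0..<M}. if [a j * y = b] (mod l) then M ^ card J * l else 0)"
    by (simp add: card_S cong_iff_dvd_diff dvd_diff_commute)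
  also have "\<dots> = int (card {y \<in> {0..<M}. [a j * y = b] (mod l)}) * l * M ^ card J"
    by (simp flip: sum.inter_filter)
  also have "\<dots> = (if gcd (a j) l dvd b then M ^ card (insert j J) * gcd (a j) l else 0)"
    using card_linear_cong_single[OF assms(1) \<open>l > 0\<close> \<open>l dvd M\<close>] insert.hyps by simp
  also have "gcd (a j) l = Gcd (insert M (a ` insert j J))"
    by (simp add: l_def gcd.left_commute)
  finally show ?case
    unfolding T_def .
qed

section \<open>Reduction of the system to one congruence modulo the product\<close>

theorem theorem2:
  fixes k n :: nat
    and a :: "nat \<Rightarrow> nat \<Rightarrow> int"
    and b m :: "nat \<Rightarrow> int"
  assumes "k \<ge> 1" and "n \<ge> 1"
    and "\<And>i. i \<in> {1..k} \<Longrightarrow> m i > 0"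
    and "pairwise (\<lambda>i j. coprime (m i) (m j)) {1..k}"
  shows "(solutions k n a b m \<noteq> {} \<longleftrightarrow> (\<forall>i\<in>{1..k}. row_gcd n a m i dvd b i)) \<and>
    ((\<forall>i\<in>{1..k}. row_gcd n a m i dvd b i) \<longrightarrow>
      int (card (solutions k n a b m)) =
        (\<Prod>i\<in>{1..k}. m i) ^ (n - 1) * (\<Prod>i\<in>{1..k}. row_gcd n a m i))"
proof -
  define M where "M = (\<Prod>i\<in>{1..k}. m i)"
  define l where "l i = row_gcd n a m i" for i
  have "M > 0"
    unfolding M_def using assms(3) by (intro prod_pos) auto
  \<comment> \<open>The Chinese remainder theorem is applied to each column \<open>j\<close> of
    coefficients, and then to the right sides.\<close>
  have "\<exists>x. \<forall>i\<in>{1..k}. [x = a i j] (mod m i)" for j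
    using assms(4) by (intro chinese_remainder_int) auto
  then obtain A where A: "[A j = a i j] (mod m i)" if "i \<in> {1..k}" for i j
    by metis
  obtain B where B: "[B = b i] (mod m i)" if "i \<in> {1..k}" for i
    using chinese_remainder_int[OF _ assms(4), of b] by blast
  have cong_M: "[s = t] (mod M) \<longleftrightarrow> (\<forall>i\<in>{1..k}. [s = t] (mod m i))" for s t
    unfolding M_def cong_iff_dvd_diff using assms(4) by (intro prod_dvd_iff_coprime) auto
  have sol: "solutions k n a b m =
    {x \<in> {1..n} \<rightarrow>\<^sub>E {0..<M}. [(\<Sum>j\<in>{1..n}. A j * x j) = B] (mod M)}"
  proof -
    have "[(\<Sum>j\<in>{1..n}. a i j * x j) = b i] (mod m i) \<longleftrightarrow>
        [(\<Sum>j\<in>{1..n}. A j * x j) = B] (mod m i)" if "i \<in> {1..k}" for x i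
    proof -
      have "[(\<Sum>j\<in>{1..n}. A j * x j) = (\<Sum>j\<in>{1..n}. a i j * x j)] (mod m i)"
        using A[OF that] by (intro cong_sum cong_mult) auto
      then show ?thesis
        using B[OF that] by (simp add: cong_def)
    qed
    moreover have "carrier (residue_ring M) = {0..<M}"
      by (auto simp: residue_ring_def)
    ultimately show ?thesis
      unfolding solutions_def cong_M M_def[symmetric] by auto
  qed
  have l_dvd: "l i dvd m i" for i
    by (simp add: l_def row_gcd_def)
  \<comment> \<open>Divisors of \<open>m i\<close> cannot tell \<open>a i j\<close> from
    \<open>A j\<close>. In this form every row gcd has the same first argument, so that their
    product becomes a gcd with \<open>M\<close>.\<close>
  have l_A: "l i = gcd (Gcd (A ` {1..n})) (m i)" if "i \<in> {1..k}" for i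
  proof (rule zdvd_antisym_nonneg)
    have *: "d dvd a i j \<longleftrightarrow> d dvd A j" if "d dvd m i" for d j
      by (rule cong_dvd_iff[OF cong_dvd_modulus[OF cong_sym[OF A[OF \<open>i \<in> {1..k}\<close>]] that]])
    have "l i dvd a i j" if "j \<in> {1..n}" for j
      unfolding l_def row_gcd_def using that by (intro Gcd_dvd) auto
    then show "l i dvd gcd (Gcd (A ` {1..n})) (m i)"
      using l_dvd * by (intro gcd_greatest Gcd_greatest) auto
    have "gcd (Gcd (A ` {1..n})) (m i) dvd A j" if "j \<in> {1..n}" for j
      using that by (meson Gcd_dvd dvd_trans gcd_dvd1 imageI)
    then show "gcd (Gcd (A ` {1..n})) (m i) dvd l i"
      unfolding l_def row_gcd_def by (intro Gcd_greatest) (auto simp: *)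
  qed (auto simp: l_def row_gcd_def)
  have "Gcd (insert M (A ` {1..n})) = gcd (Gcd (A ` {1..n})) M"
    by (simp add: gcd.commute)
  also have "\<dots> = (\<Prod>i\<in>{1..k}. gcd (Gcd (A ` {1..n})) (m i))"
    unfolding M_def using assms(4) by (intro gcd_prod_right_coprime) auto
  also have "\<dots> = (\<Prod>i\<in>{1..k}. l i)"
    by (simp add: l_A)
  finally have Gcd_A: "Gcd (insert M (A ` {1..n})) = (\<Prod>i\<in>{1..k}. l i)" .
  have "pairwise (\<lambda>i j. coprime (l i) (l j)) {1..k}"
    using assms(4) coprime_divisors[OF l_dvd l_dvd] by (auto simp: pairwise_def)
  then have "(\<Prod>i\<in>{1..k}. l i) dvd B \<longleftrightarrow> (\<forall>i\<in>{1..k}. l i dvd B)"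
    by (intro prod_dvd_iff_coprime) auto
  \<comment> \<open>\<open>B\<close> and \<open>b i\<close> agree modulo \<open>m i\<close>, hence
    modulo its divisor \<open>l i\<close>.\<close>
  also have "\<dots> \<longleftrightarrow> (\<forall>i\<in>{1..k}. l i dvd b i)"
    using cong_dvd_iff[OF cong_dvd_modulus[OF B l_dvd]] by blast
  finally have dvd_B: "(\<Prod>i\<in>{1..k}. l i) dvd B \<longleftrightarrow> (\<forall>i\<in>{1..k}. l i dvd b i)" .
  have "int (card (solutions k n a b m)) * M =
      (if \<forall>i\<in>{1..k}. l i dvd b i then M ^ n * (\<Prod>i\<in>{1..k}. l i) else 0)"
    using card_linear_cong[OF \<open>M > 0\<close>, of "{1..n}" A B]
    unfolding Gcd_A dvd_B sol[symmetric] by simp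
  \<comment> \<open>As \<open>n\<close> is at least 1, a factor \<open>M\<close> splits off and
    cancels the extra one in the count.\<close>
  moreover have "M ^ n = M ^ (n - 1) * M"
    using assms(2) by (simp flip: power_Suc2)
  ultimately have card_sol: "int (card (solutions k n a b m)) =
      (if \<forall>i\<in>{1..k}. l i dvd b i then M ^ (n - 1) * (\<Prod>i\<in>{1..k}. l i) else 0)"
    using \<open>M > 0\<close> by (auto split: if_splits)
  have "l i > 0" if "i \<in> {1..k}" for i
    using l_A[OF that] assms(3)[OF that] by simp
  then have pos: "M ^ (n - 1) * (\<Prod>i\<in>{1..k}. l i) > 0"
    using \<open>M > 0\<close> by (intro mult_pos_pos zero_less_power prod_pos) auto
  \<comment> \<open>Solvability is read off from the count, which is positive or 0 according to the
    divisibility condition; finiteness rules out that \<open>card\<close> is 0 for an infinite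
    set.\<close>
  have "finite (solutions k n a b m)"
    unfolding sol by (simp add: finite_PiE)
  then have "solutions k n a b m \<noteq> {} \<longleftrightarrow> int (card (solutions k n a b m)) \<noteq> 0"
    by simp
  also have "\<dots> \<longleftrightarrow> (\<forall>i\<in>{1..k}. l i dvd b i)"
    unfolding card_sol using pos by presburger
  finally have "solutions k n a b m \<noteq> {} \<longleftrightarrow> (\<forall>i\<in>{1..k}. l i dvd b i)" .
  with card_sol show ?thesis
    by (simp add: l_def M_def)
qed

end
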